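(* Let $M$ be a $G$-graded $R$-module and let $N$ be a graded $R$-submodule of $M$. (1) If $N$ is a graded prime $R$-submodule of $M$, then $N$ is a graded $1$-absorbing prime $R$-submodule of $M$. (2) If $N$ is a graded $1$-absorbing prime $R$-submodule of $M$, then $N$ is a graded $2$-absorbing $R$-submodule of $M$.
   Context: $G$ is a group with identity $e$; $R=\bigoplus_{g\in G}R_g$ is a commutative $G$-graded ring with nonzero unity $1$ (each $R_g$ an additive subgroup, $R_gR_h\subseteq R_{gh}$); a $G$-graded $R$-module is a unital $R$-module $M=\bigoplus_{g\in G}M_g$ (each $M_g$ an additive subgroup) with $R_gM_h\subseteq M_{gh}$. Write $h(R)=\bigcup_g R_g$ and $h(M)=\bigcup_g M_g$ for the sets of homogeneous elements. A submodule $N$ of $M$ is graded if $N=\bigoplus_g (N\cap M_g)$. $(N:_RM)=\{r\in R: rM\subseteq N\}$. Let $N$ be a proper graded $R$-submodule of $M$. $N$ is graded prime if whenever $x\in h(R)$, $m\in h(M)$ and $xm\in N$, then $m\in N$ or $x\in (N:_RM)$. $N$ is graded $1$-absorbing prime if for all non-unit elements $x,y\in h(R)$ and all $m\in h(M)$ with $xym\in N$, either $xy\in (N:_RM)$ or $m\in N$. $N$ is graded $2$-absorbing if whenever $x,y\in h(R)$, $m\in h(M)$ and $xym\in N$, then $xm\in N$ or $ym\in N$ or $xy\in (N:_RM)$. *)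

theory Defs
  imports "HOL-Algebra.Algebra"
begin

text \<open>
  \<open>H = \<Oplus>\<^sub>i\<^sub>\<in>\<^sub>I D i\<close> as an internal direct sum of additive subgroups of \<open>A\<close>: every element of
  \<open>H\<close> is the sum of exactly one finitely supported family with components in the \<open>D i\<close>, and
  all such sums lie in \<open>H\<close>.  \<open>gfinprod (add_monoid A)\<close> is the sum over the support of a family;
  families are \<open>undefined\<close> outside \<open>I\<close>, which makes uniqueness meaningful.
\<close>

definition internal_direct_sum ::
    "('a, 'm) ring_scheme \<Rightarrow> 'i set \<Rightarrow> ('i \<Rightarrow> 'a set) \<Rightarrow> 'a set \<Rightarrow> bool" where
  "internal_direct_sum A I D H \<longleftrightarrow>
     (\<forall>i\<in>I. additive_subgroup (D i) A) \<and>
     bij_betw (\<lambda>f. gfinprod (add_monoid A) f I)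
       {f \<in> (\<Pi>\<^sub>E i\<in>I. D i). finite {i \<in> I. f i \<noteq> \<zero>\<^bsub>A\<^esub>}} H"

locale graded_cring = G?: group G + R?: cring R
  for G :: "('g, 'x) monoid_scheme" (structure)
    and R :: "('r, 'y) ring_scheme" (structure)
    and \<R> :: "'g \<Rightarrow> 'r set" +
  assumes one_not_zero: "\<one>\<^bsub>R\<^esub> \<noteq> \<zero>\<^bsub>R\<^esub>"
    and ring_direct_sum: "internal_direct_sum R (carrier G) \<R> (carrier R)"
    and ring_mult_degree:
      "\<lbrakk>g \<in> carrier G; h \<in> carrier G; a \<in> \<R> g; b \<in> \<R> h\<rbrakk>
        \<Longrightarrow> a \<otimes>\<^bsub>R\<^esub> b \<in> \<R> (g \<otimes>\<^bsub>G\<^esub> h)"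

locale graded_module = graded_cring G R \<R> + module R M
  for G :: "('g, 'x) monoid_scheme" (structure)
    and R :: "('r, 'y) ring_scheme" (structure)
    and \<R> :: "'g \<Rightarrow> 'r set"
    and M :: "('r, 'm, 'z) module_scheme" (structure)
    and \<M> :: "'g \<Rightarrow> 'm set" +
  assumes module_direct_sum: "internal_direct_sum M (carrier G) \<M> (carrier M)"
    and smult_degree:
      "\<lbrakk>g \<in> carrier G; h \<in> carrier G; a \<in> \<R> g; m \<in> \<M> h\<rbrakk>
        \<Longrightarrow> a \<odot>\<^bsub>M\<^esub> m \<in> \<M> (g \<otimes>\<^bsub>G\<^esub> h)"

definition homogeneous :: "('g, 'x) monoid_scheme \<Rightarrow> ('g \<Rightarrow> 'a set) \<Rightarrow> 'a set" where
  "homogeneous G \<A> = (\<Union>g\<in>carrier G. \<A> g)"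

definition graded_submodule ::
    "('g, 'x) monoid_scheme \<Rightarrow> ('r, 'y) ring_scheme \<Rightarrow> ('r, 'm, 'z) module_scheme
      \<Rightarrow> ('g \<Rightarrow> 'm set) \<Rightarrow> 'm set \<Rightarrow> bool" where
  "graded_submodule G R M \<M> N \<longleftrightarrow>
     submodule N R M \<and> internal_direct_sum M (carrier G) (\<lambda>g. N \<inter> \<M> g) N"

definition module_colon ::
    "('r, 'y) ring_scheme \<Rightarrow> ('r, 'm, 'z) module_scheme \<Rightarrow> 'm set \<Rightarrow> 'r set" where
  "module_colon R M N = {r \<in> carrier R. \<forall>m\<in>carrier M. r \<odot>\<^bsub>M\<^esub> m \<in> N}"

definition graded_prime ::
    "('g, 'x) monoid_scheme \<Rightarrow> ('r, 'y) ring_scheme \<Rightarrow> ('g \<Rightarrow> 'r set)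
      \<Rightarrow> ('r, 'm, 'z) module_scheme \<Rightarrow> ('g \<Rightarrow> 'm set) \<Rightarrow> 'm set \<Rightarrow> bool" where
  "graded_prime G R \<R> M \<M> N \<longleftrightarrow>
     graded_submodule G R M \<M> N \<and> N \<noteq> carrier M \<and>
     (\<forall>x\<in>homogeneous G \<R>. \<forall>m\<in>homogeneous G \<M>.
        x \<odot>\<^bsub>M\<^esub> m \<in> N \<longrightarrow> m \<in> N \<or> x \<in> module_colon R M N)"

definition graded_1_absorbing_prime ::
    "('g, 'x) monoid_scheme \<Rightarrow> ('r, 'y) ring_scheme \<Rightarrow> ('g \<Rightarrow> 'r set)
      \<Rightarrow> ('r, 'm, 'z) module_scheme \<Rightarrow> ('g \<Rightarrow> 'm set) \<Rightarrow> 'm set \<Rightarrow> bool" where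
  "graded_1_absorbing_prime G R \<R> M \<M> N \<longleftrightarrow>
     graded_submodule G R M \<M> N \<and> N \<noteq> carrier M \<and>
     (\<forall>x\<in>homogeneous G \<R> - Units R. \<forall>y\<in>homogeneous G \<R> - Units R. \<forall>m\<in>homogeneous G \<M>.
        (x \<otimes>\<^bsub>R\<^esub> y) \<odot>\<^bsub>M\<^esub> m \<in> N \<longrightarrow> x \<otimes>\<^bsub>R\<^esub> y \<in> module_colon R M N \<or> m \<in> N)"

definition graded_2_absorbing ::
    "('g, 'x) monoid_scheme \<Rightarrow> ('r, 'y) ring_scheme \<Rightarrow> ('g \<Rightarrow> 'r set)
      \<Rightarrow> ('r, 'm, 'z) module_scheme \<Rightarrow> ('g \<Rightarrow> 'm set) \<Rightarrow> 'm set \<Rightarrow> bool" where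
  "graded_2_absorbing G R \<R> M \<M> N \<longleftrightarrow>
     graded_submodule G R M \<M> N \<and> N \<noteq> carrier M \<and>
     (\<forall>x\<in>homogeneous G \<R>. \<forall>y\<in>homogeneous G \<R>. \<forall>m\<in>homogeneous G \<M>.
        (x \<otimes>\<^bsub>R\<^esub> y) \<odot>\<^bsub>M\<^esub> m \<in> N \<longrightarrow>
          x \<odot>\<^bsub>M\<^esub> m \<in> N \<or> y \<odot>\<^bsub>M\<^esub> m \<in> N \<or> x \<otimes>\<^bsub>R\<^esub> y \<in> module_colon R M N)"

end

theory Submission
  imports Defs
begin

text \<open>Homogeneous elements of R are closed under products, so graded primeness can be tested
  on the single scalar xy; this gives (1). For (2), split on whether x or y is a unit. A unit factor
  can be cancelled from a membership in N (\<open>smult_unit_cancel\<close>), which leaves ym or xm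
  in N. If neither is a unit, the 1-absorbing condition applies and yields xy in (N : M), or m in N
  and hence xm in N.\<close>

lemma homogeneous_subset_carrier:
  assumes "internal_direct_sum A (carrier G) D H"
  shows "homogeneous G D \<subseteq> carrier A"
  using assms unfolding internal_direct_sum_def homogeneous_def
  by (auto dest!: bspec additive_subgroup.a_subset)

lemma (in graded_cring) homogeneous_mult_closed:
  assumes "x \<in> homogeneous G \<R>" "y \<in> homogeneous G \<R>"
  shows "x \<otimes>\<^bsub>R\<^esub> y \<in> homogeneous G \<R>"
  using assms ring_mult_degree unfolding homogeneous_def by blast

text \<open>Multiply by \<open>inv u\<close>. Since N is closed under all scalars of R, no
  homogeneity of the inverse has to be checked.\<close>

lemma (in module) smult_unit_cancel:
  assumes N: "submodule N R M" and u: "u \<in> Units R" and m: "m \<in> carrier M"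
    and um: "u \<odot>\<^bsub>M\<^esub> m \<in> N"
  shows "m \<in> N"
proof -
  have "inv u \<odot>\<^bsub>M\<^esub> (u \<odot>\<^bsub>M\<^esub> m) \<in> N"
    using submodule.smult_closed[OF N] u um by simp
  moreover have "inv u \<odot>\<^bsub>M\<^esub> (u \<odot>\<^bsub>M\<^esub> m) = m"
    using u m by (simp add: smult_assoc1[symmetric] R.Units_closed)
  ultimately show ?thesis by simp
qed

text \<open>If x and y have degrees g and h, then xy lies in degree gh, so it can serve as the
  homogeneous scalar in the definition of graded prime.\<close>

lemma (in graded_module) graded_prime_imp_1_absorbing_prime:
  assumes "graded_prime G R \<R> M \<M> N"
  shows "graded_1_absorbing_prime G R \<R> M \<M> N"
  using assms homogeneous_mult_closed
  unfolding graded_prime_def graded_1_absorbing_prime_def by blast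

lemma (in graded_module) graded_1_absorbing_prime_imp_2_absorbing:
  assumes N: "graded_1_absorbing_prime G R \<R> M \<M> N"
  shows "graded_2_absorbing G R \<R> M \<M> N"
proof -
  have sub: "submodule N R M"
    using N by (simp add: graded_1_absorbing_prime_def graded_submodule_def)
  have "x \<odot>\<^bsub>M\<^esub> m \<in> N \<or> y \<odot>\<^bsub>M\<^esub> m \<in> N \<or> x \<otimes>\<^bsub>R\<^esub> y \<in> module_colon R M N"
    if x: "x \<in> homogeneous G \<R>" and y: "y \<in> homogeneous G \<R>" and m: "m \<in> homogeneous G \<M>"
      and xym: "(x \<otimes>\<^bsub>R\<^esub> y) \<odot>\<^bsub>M\<^esub> m \<in> N" for x y m
  proof -
    have carr: "x \<in> carrier R" "y \<in> carrier R" "m \<in> carrier M"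
      using x y m homogeneous_subset_carrier[OF ring_direct_sum]
        homogeneous_subset_carrier[OF module_direct_sum] by auto
    consider "x \<in> Units R" | "y \<in> Units R" | "x \<notin> Units R" "y \<notin> Units R" by blast
    then show ?thesis
    proof cases
      case 1
      \<comment> \<open>Reassociated so that the unit x is the outer scalar; cancelling it gives the
        second disjunct.\<close>
      have "x \<odot>\<^bsub>M\<^esub> (y \<odot>\<^bsub>M\<^esub> m) \<in> N"
        using xym carr by (simp add: smult_assoc1)
      then show ?thesis
        using smult_unit_cancel[OF sub 1] carr by simp
    next
      case 2
      \<comment> \<open>Commutativity of R brings the unit y to the outside; cancelling it gives the
        first disjunct.\<close>
      have "y \<odot>\<^bsub>M\<^esub> (x \<odot>\<^bsub>M\<^esub> m) \<in> N"
        using xym carr by (simp add: smult_assoc1[symmetric] R.m_comm)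
      then show ?thesis
        using smult_unit_cancel[OF sub 2] carr by simp
    next
      case 3
      then have "x \<otimes>\<^bsub>R\<^esub> y \<in> module_colon R M N \<or> m \<in> N"
        using N x y m xym unfolding graded_1_absorbing_prime_def by blast
      \<comment> \<open>The alternative m in N is absorbed into the first disjunct, by scaling with
        x.\<close>
      then show ?thesis
        using submodule.smult_closed[OF sub] carr by blast
    qed
  qed
  then show ?thesis
    using N unfolding graded_1_absorbing_prime_def graded_2_absorbing_def by blast
qed

theorem proposition2p3:
  fixes G :: "('g, 'x) monoid_scheme"
    and R :: "('r, 'y) ring_scheme"
    and \<R> :: "'g \<Rightarrow> 'r set"
    and M :: "('r, 'm, 'z) module_scheme"
    and \<M> :: "'g \<Rightarrow> 'm set"
    and N :: "'m set"
  assumes "graded_module G R \<R> M \<M>"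
    and "graded_submodule G R M \<M> N"
  shows "(graded_prime G R \<R> M \<M> N \<longrightarrow> graded_1_absorbing_prime G R \<R> M \<M> N)
       \<and> (graded_1_absorbing_prime G R \<R> M \<M> N \<longrightarrow> graded_2_absorbing G R \<R> M \<M> N)"
  using graded_module.graded_prime_imp_1_absorbing_prime[OF assms(1)]
    graded_module.graded_1_absorbing_prime_imp_2_absorbing[OF assms(1)]
  by blast

end
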